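(* Let $P$ be a finite graded poset. Then $P$ is an Eeta win if and only if $\mathcal{M}_P(m)$ is an Eeta win for every maximal element $m\in P$.
   Context: Ungar game: for a finite poset $P$, the positions are order ideals (down-closed subsets) $X$ of $P$, the starting position being $X=P$. A nontrivial Ungar move replaces $X$ by $X\setminus T$, where $T$ is a nonempty subset of the set $\max(X)$ of maximal elements of $X$. Two players, Atniss (who moves first) and Eeta (who moves second), alternate making nontrivial Ungar moves; the first player who cannot make one (i.e. the player to move when $X=\varnothing$) loses. A finite poset $P$ is an Atniss win if the first player has a winning strategy starting from $P$, and an Eeta win otherwise. Any subset of a poset is regarded as a poset with the induced order (and so is itself an Atniss win or an Eeta win). A poset $P$ is graded if there is a rank function $\rho:P\to\mathbb{N}$ with $\rho(x)=\rho(y)+1$ whenever $x$ covers $y$ (maximal elements need not have equal rank, nor minimal elements). For a maximal element $m$ of $P$, the maximal subposet at $m$, denoted $\mathcal{M}_P(m)$, is the subposet of $P$ consisting of all elements that are less than or equal to $m$ but are not less than or equal to any other maximal element of $P$. *)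

theory Defs
  imports Main
begin

text \<open>A poset is a subset of an ordered type with the induced order; the order on a
  subset is again the induced one, so subposets are just subsets.\<close>

definition max_elems :: "'a::order set \<Rightarrow> 'a set" where
  "max_elems X = {m \<in> X. \<not> (\<exists>y\<in>X. m < y)}"

text \<open>Covering is relative to the poset: only elements of \<open>P\<close> may lie in between.\<close>

definition covers_in :: "'a::order set \<Rightarrow> 'a \<Rightarrow> 'a \<Rightarrow> bool" where
  "covers_in P x y \<longleftrightarrow> x \<in> P \<and> y \<in> P \<and> y < x \<and> \<not> (\<exists>z\<in>P. y < z \<and> z < x)"

definition graded_poset :: "'a::order set \<Rightarrow> bool" where
  "graded_poset P \<longleftrightarrow> (\<exists>\<rho>::'a \<Rightarrow> nat. \<forall>x y. covers_in P x y \<longrightarrow> \<rho> x = \<rho> y + 1)"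

definition maximal_subposet :: "'a::order set \<Rightarrow> 'a \<Rightarrow> 'a set" where
  "maximal_subposet P m = {x \<in> P. x \<le> m \<and> (\<forall>m' \<in> max_elems P. m' \<noteq> m \<longrightarrow> \<not> x \<le> m')}"

definition ungar_move :: "'a::order set \<Rightarrow> 'a set \<Rightarrow> bool" where
  "ungar_move X Y \<longleftrightarrow> (\<exists>T. T \<noteq> {} \<and> T \<subseteq> max_elems X \<and> Y = X - T)"

text \<open>A play is recorded as the chronological list of its positions, starting with \<open>P\<close>
  itself. All positions are order ideals of \<open>P\<close>, since removing maximal elements of an
  order ideal leaves an order ideal. After \<open>n\<close> moves the list has length \<open>n + 1\<close>, so it is
  the first player's turn exactly when the length is odd.\<close>

definition ungar_play :: "'a::order set \<Rightarrow> 'a set list \<Rightarrow> bool" where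
  "ungar_play P h \<longleftrightarrow> h \<noteq> [] \<and> hd h = P \<and> successively ungar_move h"

definition atniss_to_move :: "'a::order set list \<Rightarrow> bool" where
  "atniss_to_move h \<longleftrightarrow> odd (length h)"

definition finished :: "'a::order set list \<Rightarrow> bool" where
  "finished h \<longleftrightarrow> \<not> (\<exists>Y. ungar_move (last h) Y)"

text \<open>A strategy for Atniss maps the play so far to her next position; it has to
  prescribe a legal move whenever it is her turn and she can move.\<close>

definition atniss_strategy :: "'a::order set \<Rightarrow> ('a set list \<Rightarrow> 'a set) \<Rightarrow> bool" where
  "atniss_strategy P \<sigma> \<longleftrightarrow>
     (\<forall>h. ungar_play P h \<and> atniss_to_move h \<and> \<not> finished h \<longrightarrow> ungar_move (last h) (\<sigma> h))"

definition follows :: "('a::order set list \<Rightarrow> 'a set) \<Rightarrow> 'a set list \<Rightarrow> bool" where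
  "follows \<sigma> h \<longleftrightarrow>
     (\<forall>k. 0 < k \<and> k < length h \<and> atniss_to_move (take k h) \<longrightarrow> h ! k = \<sigma> (take k h))"

text \<open>Whoever is to move in a finished play loses. Intended for finite \<open>P\<close>, where every
  play can be continued to a finished one.\<close>

definition atniss_win :: "'a::order set \<Rightarrow> bool" where
  "atniss_win P \<longleftrightarrow> (\<exists>\<sigma>. atniss_strategy P \<sigma> \<and>
     (\<forall>h. ungar_play P h \<and> follows \<sigma> h \<and> finished h \<longrightarrow> \<not> atniss_to_move h))"

definition eeta_win :: "'a::order set \<Rightarrow> bool" where
  "eeta_win P \<longleftrightarrow> \<not> atniss_win P"

end

theory Submission
  imports Defs
begin

text \<open>
  Everything rests on the recursion \<open>atniss_win_iff_move_to_eeta_win\<close>: a finite position is a win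
  for the player to move iff some move leads to a win for the other one. The theorem then goes by
  induction on the size of \<open>P\<close>. Let \<open>\<rho>\<close> be the rank function and write \<open>M(m)\<close> for the maximal
  subposet at \<open>m\<close>. Since \<open>m\<close> is the only maximal element of \<open>M(m)\<close>, the sole move from \<open>M(m)\<close>
  removes \<open>m\<close>, so \<open>M(m)\<close> and \<open>M(m) - {m}\<close> have opposite outcomes.

  The rank enters through the following locality. Let \<open>T\<close> be a move and \<open>t \<in> T\<close> of minimal rank.
  The maximal elements \<open>s\<close> of \<open>M(t) - {t}\<close> are maximal in \<open>P - T\<close>, and the maximal subposets there
  are the same whether formed in \<open>P - T\<close> or in \<open>M(t) - {t}\<close>
  (\<open>maximal_subposet_below_removed\<close>): the removal of another \<open>t' \<in> T\<close> could enlarge one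
  only if \<open>s\<close> were strictly above an element covered by \<open>t'\<close>, but then \<open>\<rho> s \<ge> \<rho> t' \<ge> \<rho> t\<close>
  although \<open>s < t\<close>.

  Consequently, if \<open>M(t)\<close> is an Eeta win, then \<open>M(t) - {t}\<close> is an Atniss win, so by induction one
  of its maximal subposets is an Atniss win; this is also one of \<open>P - T\<close>, which is by induction an
  Atniss win. That is, if \<open>T\<close> is a winning move, then \<open>M(t)\<close> is an Atniss win for every
  \<open>t \<in> T\<close> of minimal rank (\<open>min_rank_of_winning_move\<close>). In particular, if all
  \<open>M(m)\<close> are Eeta wins, there is no winning move.

  Conversely, let \<open>t\<close> have minimal rank among the maximal elements whose maximal subposet is an
  Atniss win. If \<open>P - {t}\<close> is an Eeta win, removing \<open>t\<close> wins. Otherwise \<open>P - {t}\<close> has a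
  winning move \<open>U\<close>, and the elements \<open>u \<in> U\<close> of minimal rank have a maximal subposet in
  \<open>P - {t}\<close> that is an Atniss win. Such a \<open>u\<close> is not newly maximal, because the maximal subposets
  at newly maximal elements are those of the Eeta win \<open>M(t) - {t}\<close>, which by induction are Eeta wins.
  Nor is its rank below \<open>\<rho> t\<close>, because the removal of \<open>t\<close> leaves the maximal subposets at
  old maximal elements of rank below \<open>\<rho> t\<close> unchanged (\<open>maximal_subposet_low_rank\<close>), and these are
  Eeta wins by the choice of \<open>t\<close>. So all of \<open>U\<close> has rank at least \<open>\<rho> t\<close>. Newly maximal elements
  lie below \<open>t\<close>, hence \<open>U\<close> contains none of them, and \<open>U \<union> {t}\<close> is a winning move from \<open>P\<close>.
\<close>

section \<open>Recursion for the outcome of the game\<close>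

lemma ungar_play_Cons_Cons:
  assumes "g \<noteq> []"
  shows "ungar_play X (A # B # g) \<longleftrightarrow>
    A = X \<and> ungar_move X B \<and> ungar_move B (hd g) \<and> ungar_play (hd g) g"
  using assms by (cases g) (auto simp: ungar_play_def)

lemma follows_Cons_Cons:
  assumes "g \<noteq> []"
  shows "follows \<sigma> (A # B # g) \<longleftrightarrow> B = \<sigma> [A] \<and> follows (\<lambda>h. \<sigma> (A # B # h)) g"
    (is "?l \<longleftrightarrow> ?r")
proof
  assume l: ?l
  have "B = \<sigma> [A]"
    using l[unfolded follows_def, rule_format, of 1] by (simp add: atniss_to_move_def)
  moreover have "g ! k = \<sigma> (A # B # take k g)"
    if "0 < k" "k < length g" "atniss_to_move (take k g)" for k
    using l[unfolded follows_def, rule_format, of "Suc (Suc k)"] that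
    by (simp add: atniss_to_move_def)
  ultimately show ?r by (simp add: follows_def)
next
  assume r: ?r
  show ?l
    unfolding follows_def
  proof (intro allI impI, elim conjE)
    fix k assume k: "0 < k" "k < length (A # B # g)" "atniss_to_move (take k (A # B # g))"
    consider "k = 1" | "k = 2" | j where "k = Suc (Suc j)" "0 < j"
      using k(1) by (metis One_nat_def Suc_1 gr0_conv_Suc neq0_conv)
    then show "(A # B # g) ! k = \<sigma> (take k (A # B # g))"
    proof cases
      case 1
      then show ?thesis using r by simp
    next
      case 2
      then show ?thesis using k assms by (simp add: atniss_to_move_def)
    next
      case (3 j)
      then show ?thesis using r k by (simp add: follows_def atniss_to_move_def)
    qed
  qed
qed

lemma follows_cong:
  assumes "\<And>k. 0 < k \<Longrightarrow> k < length h \<Longrightarrow> \<sigma> (take k h) = \<tau> (take k h)"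
  shows "follows \<sigma> h \<longleftrightarrow> follows \<tau> h"
  using assms by (auto simp: follows_def)

lemma atniss_strategy_exists: "\<exists>\<sigma>. atniss_strategy X \<sigma>"
proof
  show "atniss_strategy X (\<lambda>h. SOME Y. ungar_move (last h) Y)"
    by (auto simp: atniss_strategy_def finished_def intro: someI)
qed

text \<open>A play of at least three positions is its first round followed by a play with the same
  player to move. Strategies are transported along this correspondence: a winning strategy from
  \<open>X\<close> restricts to one from each position after the first round, and conversely winning strategies
  for all those positions are glued together.\<close>

lemma atniss_win_iff_two_moves:
  fixes X :: "'a::order set"
  shows "atniss_win X \<longleftrightarrow> (\<exists>Y. ungar_move X Y \<and> (\<forall>Z. ungar_move Y Z \<longrightarrow> atniss_win Z))"
proof
  assume "atniss_win X"
  then obtain \<sigma> where \<sigma>: "atniss_strategy X \<sigma>"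
    and win: "\<And>h. ungar_play X h \<Longrightarrow> follows \<sigma> h \<Longrightarrow> finished h \<Longrightarrow> \<not> atniss_to_move h"
    unfolding atniss_win_def by blast
  define Y where "Y = \<sigma> [X]"
  have start: "ungar_play X [X]" "follows \<sigma> [X]" "atniss_to_move [X]"
    by (auto simp: ungar_play_def follows_def atniss_to_move_def)
  then have "\<not> finished [X]"
    using win by blast
  with \<sigma> start have XY: "ungar_move X Y"
    unfolding atniss_strategy_def Y_def by (metis last.simps)
  have "atniss_win Z" if YZ: "ungar_move Y Z" for Z
  proof -
    let ?\<tau> = "\<lambda>h. \<sigma> (X # Y # h)"
    have play: "g \<noteq> []" "ungar_play X (X # Y # g)" if "ungar_play Z g" for g
      using that XY YZ ungar_play_Cons_Cons[of g X X Y] by (auto simp: ungar_play_def)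
    have "atniss_strategy Z ?\<tau>"
      unfolding atniss_strategy_def
    proof (intro allI impI, elim conjE)
      fix g assume g: "ungar_play Z g" "atniss_to_move g" "\<not> finished g"
      with \<sigma> play[OF g(1)] show "ungar_move (last g) (\<sigma> (X # Y # g))"
        unfolding atniss_strategy_def
        by (drule_tac x = "X # Y # g" in spec) (auto simp: atniss_to_move_def finished_def)
    qed
    moreover have "\<not> atniss_to_move g"
      if g: "ungar_play Z g" "follows ?\<tau> g" "finished g" for g
      using win[of "X # Y # g"] play[OF g(1)] g(2,3)
      by (auto simp: atniss_to_move_def finished_def Y_def follows_Cons_Cons)
    ultimately show ?thesis
      unfolding atniss_win_def by blast
  qed
  with XY show "\<exists>Y. ungar_move X Y \<and> (\<forall>Z. ungar_move Y Z \<longrightarrow> atniss_win Z)"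
    by blast
next
  assume "\<exists>Y. ungar_move X Y \<and> (\<forall>Z. ungar_move Y Z \<longrightarrow> atniss_win Z)"
  then obtain Y where XY: "ungar_move X Y" and Y: "\<And>Z. ungar_move Y Z \<Longrightarrow> atniss_win Z"
    by blast
  \<comment> \<open>A strategy must be legal even on plays that deviate from it, so a legal one is needed also at
      positions from which Atniss does not win.\<close>
  have "\<forall>Z :: 'a set. \<exists>\<tau>. atniss_strategy Z \<tau> \<and> (atniss_win Z \<longrightarrow>
      (\<forall>h. ungar_play Z h \<and> follows \<tau> h \<and> finished h \<longrightarrow> \<not> atniss_to_move h))"
    using atniss_strategy_exists unfolding atniss_win_def by metis
  then obtain \<tau> where \<tau>: "\<And>Z :: 'a set. atniss_strategy Z (\<tau> Z)"
    and win: "\<And>(Z :: 'a set) h. atniss_win Z \<Longrightarrow> ungar_play Z h \<Longrightarrow> follows (\<tau> Z) h \<Longrightarrow> finished h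
      \<Longrightarrow> \<not> atniss_to_move h"
    by metis
  define \<sigma> where "\<sigma> = (\<lambda>h. if length h = 1 then Y else \<tau> (h ! 2) (drop 2 h))"
  have \<sigma>_later: "\<sigma> (A # B # g) = \<tau> (hd g) g" if "g \<noteq> []" for A B g
    using that by (simp add: \<sigma>_def hd_conv_nth)
  have long: "\<exists>A B g. h = A # B # g \<and> g \<noteq> []" if "atniss_to_move h" "length h \<noteq> 1"
    for h :: "'a set list"
    using that by (cases h; cases "tl h"; cases "tl (tl h)") (auto simp: atniss_to_move_def)
  have "atniss_strategy X \<sigma>"
    unfolding atniss_strategy_def
  proof (intro allI impI, elim conjE)
    fix h assume h: "ungar_play X h" "atniss_to_move h" "\<not> finished h"
    show "ungar_move (last h) (\<sigma> h)"
    proof (cases "length h = 1")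
      case True
      then show ?thesis
        using h(1) XY by (cases h) (auto simp: \<sigma>_def ungar_play_def)
    next
      case False
      then obtain A B g where g: "h = A # B # g" "g \<noteq> []"
        using long h(2) by blast
      with h have "ungar_play (hd g) g" "atniss_to_move g" "\<not> finished g"
        by (auto simp: ungar_play_Cons_Cons atniss_to_move_def finished_def)
      then have "ungar_move (last g) (\<tau> (hd g) g)"
        using \<tau> by (auto simp: atniss_strategy_def)
      then show ?thesis
        using g by (simp add: \<sigma>_later)
    qed
  qed
  moreover have "\<not> atniss_to_move h"
    if h: "ungar_play X h" "follows \<sigma> h" "finished h" for h
  proof
    assume odd: "atniss_to_move h"
    have "length h \<noteq> 1"
      using h(1,3) XY by (cases h) (auto simp: ungar_play_def finished_def)
    then obtain A B g where g: "h = A # B # g" "g \<noteq> []"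
      using long odd by blast
    have "B = Y"
      using h(2) g by (simp add: follows_Cons_Cons \<sigma>_def)
    with h(1) g have play: "ungar_move Y (hd g)" "ungar_play (hd g) g"
      by (auto simp: ungar_play_Cons_Cons)
    have "follows (\<lambda>f. \<sigma> (A # B # f)) g"
      using h(2) g follows_Cons_Cons by blast
    also have "follows (\<lambda>f. \<sigma> (A # B # f)) g \<longleftrightarrow> follows (\<tau> (hd g)) g"
    proof (rule follows_cong)
      fix k assume "0 < k" "k < length g"
      then show "\<sigma> (A # B # take k g) = \<tau> (hd g) (take k g)"
        using \<sigma>_later[of "take k g"] g(2) by (simp add: hd_take)
    qed
    finally have "\<not> atniss_to_move g"
      using win Y play h(3) g by (auto simp: finished_def)
    with odd g show False
      by (simp add: atniss_to_move_def)
  qed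
  ultimately show "atniss_win X"
    unfolding atniss_win_def by blast
qed

lemma ungar_move_psubset: "ungar_move X Y \<Longrightarrow> Y \<subset> X"
  by (auto simp: ungar_move_def max_elems_def)

text \<open>Passing from rounds to single moves needs that plays end: with infinite plays, an Atniss win
  only says that she can avoid losing, so a position and all its successors could be Atniss wins.\<close>

lemma eeta_win_iff_all_moves:
  assumes "finite X"
  shows "eeta_win X \<longleftrightarrow> (\<forall>Y. ungar_move X Y \<longrightarrow> atniss_win Y)"
  using assms
proof (induction X rule: finite_psubset_induct)
  case (psubset X)
  have IH: "eeta_win Y \<longleftrightarrow> (\<forall>Z. ungar_move Y Z \<longrightarrow> atniss_win Z)" if "ungar_move X Y" for Y
    using psubset.IH ungar_move_psubset[OF that] by blast
  then show ?case
    unfolding eeta_win_def using atniss_win_iff_two_moves[of X] by blast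
qed

lemma atniss_win_iff_move_to_eeta_win:
  assumes "finite X"
  shows "atniss_win X \<longleftrightarrow> (\<exists>Y. ungar_move X Y \<and> eeta_win Y)"
  using eeta_win_iff_all_moves[OF assms] unfolding eeta_win_def by blast

section \<open>Ranks and maximal elements\<close>

definition ranked_by :: "('a::order \<Rightarrow> nat) \<Rightarrow> 'a set \<Rightarrow> bool" where
  "ranked_by \<rho> P \<longleftrightarrow> (\<forall>x y. covers_in P x y \<longrightarrow> \<rho> x = \<rho> y + 1)"

lemma ranked_by_convex_subset:
  assumes "ranked_by \<rho> P" "Q \<subseteq> P"
    and "\<And>x y z. x \<in> Q \<Longrightarrow> y \<in> Q \<Longrightarrow> z \<in> P \<Longrightarrow> x < z \<Longrightarrow> z < y \<Longrightarrow> z \<in> Q"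
  shows "ranked_by \<rho> Q"
  using assms unfolding ranked_by_def covers_in_def by (meson subsetD)

lemma exists_covered_above:
  assumes "finite P" "x \<in> P" "t \<in> P" "x < t"
  shows "\<exists>y. covers_in P t y \<and> x \<le> y"
proof -
  let ?S = "{y \<in> P. x \<le> y \<and> y < t}"
  have "finite ?S" "x \<in> ?S" using assms by auto
  then obtain y where y: "y \<in> ?S" "\<And>z. z \<in> ?S \<Longrightarrow> y \<le> z \<Longrightarrow> y = z"
    using finite_has_maximal2[of ?S x] by blast
  have "\<not> (\<exists>z\<in>P. y < z \<and> z < t)"
  proof
    assume "\<exists>z\<in>P. y < z \<and> z < t"
    then obtain z where "z \<in> P" "y < z" "z < t" by blast
    with y show False by (metis (mono_tags, lifting) mem_Collect_eq order.trans less_le)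
  qed
  then show ?thesis using y(1) assms(3) by (auto simp: covers_in_def)
qed

lemma rank_strict_mono:
  assumes P: "finite P" "ranked_by \<rho> P"
  shows "x \<in> P \<Longrightarrow> t \<in> P \<Longrightarrow> x < t \<Longrightarrow> \<rho> x < \<rho> t"
proof (induction "card {z \<in> P. z < t}" arbitrary: t rule: less_induct)
  case less
  obtain y where y: "covers_in P t y" "x \<le> y"
    using exists_covered_above P(1) less.prems by blast
  have yP: "y \<in> P" "y < t" and \<rho>: "\<rho> t = \<rho> y + 1"
    using y(1) P(2) by (auto simp: covers_in_def ranked_by_def)
  show ?case
  proof (cases "x = y")
    case True
    then show ?thesis using \<rho> by simp
  next
    case False
    have "{z \<in> P. z < y} \<subset> {z \<in> P. z < t}"
      using yP by auto
    then have "card {z \<in> P. z < y} < card {z \<in> P. z < t}"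
      using P(1) by (intro psubset_card_mono) auto
    with less.hyps less.prems(1) yP(1) False y(2) have "\<rho> x < \<rho> y"
      by simp
    with \<rho> show ?thesis by simp
  qed
qed

lemma exists_max_elem_above:
  assumes "finite P" "x \<in> P"
  shows "\<exists>m \<in> max_elems P. x \<le> m"
  using finite_has_maximal2[OF assms] by (fastforce simp: max_elems_def)

lemma max_elem_eqI: "m \<in> max_elems P \<Longrightarrow> y \<in> P \<Longrightarrow> m \<le> y \<Longrightarrow> y = m"
  by (auto simp: max_elems_def order.order_iff_strict)

lemma max_elems_subset: "max_elems P \<subseteq> P"
  by (auto simp: max_elems_def)

lemma max_elem_remaining: "m \<in> max_elems P \<Longrightarrow> m \<notin> T \<Longrightarrow> m \<in> max_elems (P - T)"
  by (auto simp: max_elems_def)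

lemma maximal_subposetD:
  assumes "x \<in> maximal_subposet P m"
  shows "x \<in> P" "x \<le> m" "\<And>m'. m' \<in> max_elems P \<Longrightarrow> x \<le> m' \<Longrightarrow> m' = m"
  using assms by (auto simp: maximal_subposet_def)

text \<open>The maximal elements above \<open>z\<close> are among those above \<open>x\<close>, so \<open>m\<close> is the only one.\<close>

lemma maximal_subposet_upward:
  assumes "finite P" "x \<in> maximal_subposet P m" "z \<in> P" "x \<le> z"
  shows "z \<in> maximal_subposet P m"
proof -
  have only_m: "m' = m" if "m' \<in> max_elems P" "z \<le> m'" for m'
    using that maximal_subposetD(3)[OF assms(2)] assms(4) order_trans by blast
  obtain m' where "m' \<in> max_elems P" "z \<le> m'"
    using exists_max_elem_above[OF assms(1,3)] by blast
  with only_m assms(3) show ?thesis by (auto simp: maximal_subposet_def)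
qed

lemma max_elem_in_maximal_subposet:
  "m \<in> max_elems P \<Longrightarrow> m \<in> maximal_subposet P m"
  unfolding maximal_subposet_def using max_elem_eqI max_elems_subset by blast

lemma max_elems_maximal_subposet:
  assumes "m \<in> max_elems P"
  shows "max_elems (maximal_subposet P m) = {m}"
proof -
  have "x = m" if x: "x \<in> max_elems (maximal_subposet P m)" for x
    using max_elem_eqI[OF x max_elem_in_maximal_subposet[OF assms]] x max_elems_subset
      maximal_subposetD(2) by blast
  moreover have "m \<in> max_elems (maximal_subposet P m)"
    using max_elem_in_maximal_subposet[OF assms] assms
    by (auto simp: max_elems_def maximal_subposet_def)
  ultimately show ?thesis by blast
qed

lemma atniss_win_maximal_subposet:
  assumes "finite P" "m \<in> max_elems P"
  shows "atniss_win (maximal_subposet P m) \<longleftrightarrow> eeta_win (maximal_subposet P m - {m})"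
proof -
  have "finite (maximal_subposet P m)"
    using assms(1) by (simp add: maximal_subposet_def)
  moreover have "ungar_move (maximal_subposet P m) Y \<longleftrightarrow> Y = maximal_subposet P m - {m}" for Y
  proof -
    have "T \<noteq> {} \<and> T \<subseteq> {m} \<longleftrightarrow> T = {m}" for T
      by blast
    then show ?thesis
      by (simp add: ungar_move_def max_elems_maximal_subposet[OF assms(2)] flip: conj_assoc)
  qed
  ultimately show ?thesis
    by (simp add: atniss_win_iff_move_to_eeta_win)
qed

lemma ranked_by_maximal_subposet_minus_top:
  assumes "finite P" "ranked_by \<rho> P" "m \<in> max_elems P"
  shows "ranked_by \<rho> (maximal_subposet P m - {m})"
proof (rule ranked_by_convex_subset[OF assms(2)])
  show "maximal_subposet P m - {m} \<subseteq> P"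
    by (auto simp: maximal_subposet_def)
  fix x y z
  assume *: "x \<in> maximal_subposet P m - {m}" "y \<in> maximal_subposet P m - {m}"
    "z \<in> P" "x < z" "z < y"
  then have "z \<in> maximal_subposet P m"
    using maximal_subposet_upward[OF assms(1)] by (meson DiffD1 less_imp_le)
  moreover have "z \<noteq> m"
    using * assms(3) maximal_subposetD(1) by (force simp: max_elems_def)
  ultimately show "z \<in> maximal_subposet P m - {m}" by simp
qed

lemma ranked_by_minus_max_elems:
  assumes "ranked_by \<rho> P" "T \<subseteq> max_elems P"
  shows "ranked_by \<rho> (P - T)"
  using assms(2) by (intro ranked_by_convex_subset[OF assms(1)]) (auto simp: max_elems_def)

section \<open>How a move changes the maximal subposets\<close>

text \<open>Maximal subposets being up-closed, everything in \<open>P\<close> above \<open>s\<close> lies in \<open>M(t)\<close>; by the choice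
  of \<open>s\<close> that leaves only \<open>t\<close>, which the move removes.\<close>

lemma max_elem_below_removed:
  assumes "finite P" "T \<subseteq> max_elems P" "t \<in> T"
    and s: "s \<in> max_elems (maximal_subposet P t - {t})"
  shows "s \<in> maximal_subposet P t" "s < t" "s \<notin> max_elems P" "s \<in> max_elems (P - T)"
proof -
  show sM: "s \<in> maximal_subposet P t" and "s < t"
    using s by (auto simp: max_elems_def maximal_subposet_def order.order_iff_strict)
  then show "s \<notin> max_elems P"
    using assms(2,3) by (auto simp: max_elems_def)
  moreover have "y = t" if "y \<in> P" "s < y" for y
    using maximal_subposet_upward[OF assms(1) sM that(1)] that(2) s
    by (auto simp: max_elems_def)
  ultimately show "s \<in> max_elems (P - T)"
    using assms(2,3) maximal_subposetD(1)[OF sM] by (auto simp: max_elems_def)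
qed

text \<open>The rank enters in the inclusion from left to right. An element \<open>x \<le> s\<close> that is missing from
  \<open>M(t)\<close> because it lies below another \<open>t' \<in> T\<close> also lies below some \<open>y\<close> covered by \<open>t'\<close>. If \<open>s\<close> is
  the only maximal element of \<open>P - T\<close> above \<open>x\<close>, then \<open>y < s < t\<close>, so \<open>\<rho> t' \<le> \<rho> s < \<rho> t\<close>,
  against the choice of \<open>t\<close>.\<close>

lemma maximal_subposet_below_removed:
  assumes P: "finite P" "ranked_by \<rho> P" and T: "T \<subseteq> max_elems P" "t \<in> T"
    and min: "\<And>t'. t' \<in> T \<Longrightarrow> \<rho> t \<le> \<rho> t'"
    and s: "s \<in> max_elems (maximal_subposet P t - {t})"
  shows "maximal_subposet (P - T) s = maximal_subposet (maximal_subposet P t - {t}) s"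
    (is "?L = ?R")
proof
  note s' = max_elem_below_removed[OF P(1) T s]
  show "?L \<subseteq> ?R"
  proof
    fix x assume x: "x \<in> ?L"
    note xD = maximal_subposetD[OF x]
    have "t' = t" if t': "t' \<in> max_elems P" "x \<le> t'" for t'
    proof (rule ccontr)
      assume "t' \<noteq> t"
      show False
      proof (cases "t' \<in> T")
        case False
        then have "t' = s"
          using xD(3) t' max_elem_remaining by blast
        with s'(3) t' show False by blast
      next
        case True
        have "t' \<in> P" "x < t'"
          using t' True xD(1) max_elems_subset by (auto simp: order.order_iff_strict)
        then obtain y where y: "covers_in P t' y" "x \<le> y"
          using exists_covered_above[OF P(1)] xD(1) by blast
        have yP: "y \<in> P" "y < t'" "\<rho> t' = \<rho> y + 1"
          using y(1) P(2) by (auto simp: covers_in_def ranked_by_def)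
        then have "y \<in> P - T"
          using T(1) \<open>t' \<in> P\<close> by (auto simp: max_elems_def)
        then obtain m where "m \<in> max_elems (P - T)" "y \<le> m"
          using exists_max_elem_above P(1) by blast
        with xD(3) y(2) have "y \<le> s"
          by (metis order_trans)
        moreover have "y \<noteq> s"
          using maximal_subposetD(3)[OF s'(1) t'(1)] yP(2) \<open>t' \<noteq> t\<close> less_imp_le by blast
        ultimately have "\<rho> y < \<rho> s"
          using rank_strict_mono[OF P yP(1)] maximal_subposetD(1)[OF s'(1)] by simp
        moreover have "\<rho> s < \<rho> t"
          using rank_strict_mono[OF P] s'(2) maximal_subposetD(1)[OF s'(1)] T
            max_elems_subset by blast
        ultimately show False
          using min[OF True] yP(3) by simp
      qed
    qed
    then have "x \<in> maximal_subposet P t - {t}"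
      using xD(1,2) s'(2) by (auto simp: maximal_subposet_def)
    moreover have "m' = s" if "m' \<in> max_elems (maximal_subposet P t - {t})" "x \<le> m'" for m'
      using xD(3) that max_elem_below_removed(4)[OF P(1) T] by blast
    ultimately show "x \<in> ?R"
      using xD(2) unfolding maximal_subposet_def[of "maximal_subposet P t - {t}"] by blast
  qed
  show "?R \<subseteq> ?L"
  proof
    fix x assume x: "x \<in> ?R"
    note xR = maximal_subposetD[OF x]
    have xM: "x \<in> maximal_subposet P t" using xR(1) by simp
    note xD = maximal_subposetD[OF xM]
    have "x \<in> P - T"
      using xD(1) xR(1) xD(3)[of x] T(1) by auto
    moreover have "m = s" if m: "m \<in> max_elems (P - T)" "x \<le> m" for m
    proof -
      have "m \<in> P" "m \<noteq> t"
        using m(1) T(2) by (auto simp: max_elems_def)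
      then have mM: "m \<in> maximal_subposet P t - {t}"
        using maximal_subposet_upward[OF P(1) xM _ m(2)] by simp
      \<comment> \<open>Nothing in \<open>M(t) - {t}\<close> is maximal in \<open>P\<close>, so all of it survives the move.\<close>
      have "y \<in> P - T" if y: "y \<in> maximal_subposet P t - {t}" for y
        using y maximal_subposetD(1,3)[of y P t] T(1) by auto
      with m(1) mM have "m \<in> max_elems (maximal_subposet P t - {t})"
        unfolding max_elems_def by blast
      then show "m = s" using xR(3) m(2) by blast
    qed
    ultimately show "x \<in> ?L"
      using xR(2) unfolding maximal_subposet_def[of "P - T"] by blast
  qed
qed

text \<open>Removing \<open>t\<close> frees for \<open>u\<close> only elements below some \<open>y < u\<close> covered by \<open>t\<close>, which requires
  \<open>\<rho> u \<ge> \<rho> t\<close>.\<close>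

lemma maximal_subposet_low_rank:
  assumes P: "finite P" "ranked_by \<rho> P"
    and t: "t \<in> max_elems P" and u: "u \<in> max_elems P" and less: "\<rho> u < \<rho> t"
  shows "maximal_subposet (P - {t}) u = maximal_subposet P u"
proof
  have ut: "u \<noteq> t" using less by auto
  show "maximal_subposet P u \<subseteq> maximal_subposet (P - {t}) u"
  proof
    fix x assume x: "x \<in> maximal_subposet P u"
    note xD = maximal_subposetD[OF x]
    have "m = u" if m: "m \<in> max_elems (P - {t})" "x \<le> m" for m
    proof -
      have "m \<in> maximal_subposet P u"
        using maximal_subposet_upward[OF P(1) x _ m(2)] m(1) by (auto simp: max_elems_def)
      then have "m \<le> u" by (rule maximal_subposetD(2))
      then show "m = u"
        using max_elem_eqI[OF m(1)] u ut max_elems_subset by blast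
    qed
    moreover have "x \<noteq> t" using xD(3)[OF t] ut by auto
    ultimately show "x \<in> maximal_subposet (P - {t}) u"
      using xD(1,2) unfolding maximal_subposet_def[of "P - {t}"] by blast
  qed
  show "maximal_subposet (P - {t}) u \<subseteq> maximal_subposet P u"
  proof
    fix x assume x: "x \<in> maximal_subposet (P - {t}) u"
    note xD = maximal_subposetD[OF x]
    have "\<not> x \<le> t"
    proof
      assume "x \<le> t"
      with xD(1) have "x < t" "x \<in> P" by auto
      then obtain y where y: "covers_in P t y" "x \<le> y"
        using exists_covered_above[OF P(1)] t max_elems_subset by blast
      have yP: "y \<in> P" "y < t" "\<rho> t = \<rho> y + 1"
        using y(1) P(2) by (auto simp: covers_in_def ranked_by_def)
      then obtain m where "m \<in> max_elems (P - {t})" "y \<le> m"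
        using exists_max_elem_above[of "P - {t}" y] P(1) by auto
      with xD(3) y(2) have "y \<le> u"
        by (metis order_trans)
      moreover have "y \<noteq> u"
        using u t yP(2) by (auto simp: max_elems_def)
      ultimately have "\<rho> y < \<rho> u"
        using rank_strict_mono[OF P yP(1)] u max_elems_subset by fastforce
      with less yP(3) show False by simp
    qed
    moreover have "m = u" if "m \<in> max_elems P" "m \<noteq> t" "x \<le> m" for m
      using xD(3) that max_elem_remaining[of m P "{t}"] by simp
    ultimately show "x \<in> maximal_subposet P u"
      using xD(1,2) unfolding maximal_subposet_def[of P] by auto
  qed
qed

lemma new_max_elem:
  assumes "finite P" "t \<in> max_elems P" "u \<in> max_elems (P - {t})" "u \<notin> max_elems P"
  shows "u \<in> max_elems (maximal_subposet P t - {t})"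
proof -
  have only_t: "y = t" if "y \<in> P" "u < y" for y
    using assms(3) that by (auto simp: max_elems_def)
  have "u \<in> P" "u \<noteq> t"
    using assms(3) by (auto simp: max_elems_def)
  moreover from this assms(4) only_t have "u < t"
    by (auto simp: max_elems_def)
  moreover have "m = t" if "m \<in> max_elems P" "u \<le> m" for m
    using only_t[of m] that assms(4) max_elems_subset by (auto simp: order.order_iff_strict)
  ultimately have "u \<in> maximal_subposet P t - {t}"
    by (auto simp: maximal_subposet_def)
  with only_t show ?thesis
    by (auto simp: max_elems_def maximal_subposet_def)
qed

section \<open>The characterisation of Eeta wins\<close>

definition decided_by_maximal_subposets :: "'a::order set \<Rightarrow> bool" where
  "decided_by_maximal_subposets P \<longleftrightarrow>
     (eeta_win P \<longleftrightarrow> (\<forall>m \<in> max_elems P. eeta_win (maximal_subposet P m)))"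

text \<open>If \<open>M(t)\<close> were an Eeta win, then \<open>M(t) - {t}\<close> would have a maximal subposet that is an
  Atniss win, and \<open>P - T\<close> would inherit it. The assumption \<open>IH\<close> is the induction hypothesis under
  which this lemma is applied below.\<close>

lemma min_rank_of_winning_move:
  assumes P: "finite P" "ranked_by \<rho> P"
    and IH: "\<And>Q. Q \<subset> P \<Longrightarrow> ranked_by \<rho> Q \<Longrightarrow> decided_by_maximal_subposets Q"
    and T: "T \<subseteq> max_elems P" "t \<in> T" "\<And>t'. t' \<in> T \<Longrightarrow> \<rho> t \<le> \<rho> t'"
    and win: "eeta_win (P - T)"
  shows "atniss_win (maximal_subposet P t)"
proof (rule ccontr)
  let ?N = "maximal_subposet P t - {t}"
  assume "\<not> atniss_win (maximal_subposet P t)"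
  then have "\<not> eeta_win ?N"
    using atniss_win_maximal_subposet P(1) T(1,2) by blast
  have tP: "t \<in> P" "t \<in> max_elems P"
    using T(1,2) max_elems_subset by auto
  then have "?N \<subset> P"
    by (auto simp: maximal_subposet_def)
  then have "decided_by_maximal_subposets ?N"
    using IH ranked_by_maximal_subposet_minus_top[OF P tP(2)] by blast
  with \<open>\<not> eeta_win ?N\<close> obtain s where s: "s \<in> max_elems ?N" "\<not> eeta_win (maximal_subposet ?N s)"
    unfolding decided_by_maximal_subposets_def by blast
  then have "\<not> eeta_win (maximal_subposet (P - T) s)"
    using maximal_subposet_below_removed[OF P T] by simp
  moreover have "decided_by_maximal_subposets (P - T)"
    using IH ranked_by_minus_max_elems[OF P(2) T(1)] T(2) tP(1) by blast
  ultimately show False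
    using win max_elem_below_removed(4)[OF P(1) T(1,2) s(1)]
    unfolding decided_by_maximal_subposets_def by blast
qed

lemma ranked_decided_by_maximal_subposets:
  assumes "finite P" "ranked_by \<rho> P"
  shows "decided_by_maximal_subposets P"
  using assms
proof (induction P rule: finite_psubset_induct)
  case (psubset P)
  note P = psubset.hyps psubset.prems and IH = psubset.IH
  define B where "B = {m \<in> max_elems P. atniss_win (maximal_subposet P m)}"
  have "atniss_win P \<longleftrightarrow> B \<noteq> {}"
  proof
    assume "atniss_win P"
    then obtain T where T: "T \<noteq> {}" "T \<subseteq> max_elems P" "eeta_win (P - T)"
      using atniss_win_iff_move_to_eeta_win[OF P(1)] by (auto simp: ungar_move_def)
    obtain t where "t \<in> T" "\<And>t'. t' \<in> T \<Longrightarrow> \<rho> t \<le> \<rho> t'"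
      using T(1) ex_has_least_nat[of "\<lambda>x. x \<in> T" _ \<rho>] by blast
    then show "B \<noteq> {}"
      using min_rank_of_winning_move[OF P IH T(2)] T(2,3) by (auto simp: B_def)
  next
    assume "B \<noteq> {}"
    then obtain t where tB: "t \<in> B" and min: "\<And>t'. t' \<in> B \<Longrightarrow> \<rho> t \<le> \<rho> t'"
      using ex_has_least_nat[of "\<lambda>x. x \<in> B" _ \<rho>] by blast
    then have t: "t \<in> max_elems P" "t \<in> P" and eeta: "eeta_win (maximal_subposet P t - {t})"
      using atniss_win_maximal_subposet[OF P(1)] max_elems_subset by (auto simp: B_def)
    let ?Q = "P - {t}" and ?N = "maximal_subposet P t - {t}"
    have Q: "finite ?Q" "ranked_by \<rho> ?Q" "?Q \<subset> P"
      using P t ranked_by_minus_max_elems[of \<rho> P "{t}"] by auto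
    have "?N \<subset> P"
      using t(2) by (auto simp: maximal_subposet_def)
    then have "decided_by_maximal_subposets ?N"
      using IH ranked_by_maximal_subposet_minus_top[OF P t(1)] by blast
    with eeta have N: "eeta_win (maximal_subposet ?N s)" if "s \<in> max_elems ?N" for s
      using that by (simp add: decided_by_maximal_subposets_def)
    have new: "eeta_win (maximal_subposet ?Q s)" "\<rho> s < \<rho> t" if "s \<in> max_elems ?N" for s
    proof -
      show "eeta_win (maximal_subposet ?Q s)"
        using maximal_subposet_below_removed[OF P, of "{t}" t s] N that t(1) by simp
      show "\<rho> s < \<rho> t"
        using max_elem_below_removed(1,2)[OF P(1), of "{t}" t s] that t
          rank_strict_mono[OF P] maximal_subposetD(1) by blast
    qed
    show "atniss_win P"
    proof (cases "eeta_win ?Q")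
      case True
      moreover have "ungar_move P ?Q"
        using t(1) by (auto simp: ungar_move_def)
      ultimately show ?thesis
        using atniss_win_iff_move_to_eeta_win[OF P(1)] by blast
    next
      case False
      then obtain U where U: "U \<noteq> {}" "U \<subseteq> max_elems ?Q" "eeta_win (?Q - U)"
        using atniss_win_iff_move_to_eeta_win[OF Q(1)] by (auto simp: ungar_move_def eeta_win_def)
      obtain u where u: "u \<in> U" "\<And>u'. u' \<in> U \<Longrightarrow> \<rho> u \<le> \<rho> u'"
        using U(1) ex_has_least_nat[of "\<lambda>x. x \<in> U" _ \<rho>] by blast
      have "atniss_win (maximal_subposet ?Q u)"
        using min_rank_of_winning_move[OF Q(1,2) _ U(2) u U(3)] IH Q(3) by blast
      then have "u \<in> max_elems P"
        using new(1) new_max_elem[OF P(1) t(1)] u(1) U(2) by (auto simp: eeta_win_def)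
      have "\<rho> t \<le> \<rho> u"
      proof (rule ccontr)
        assume "\<not> \<rho> t \<le> \<rho> u"
        then have "u \<in> B"
          using \<open>atniss_win (maximal_subposet ?Q u)\<close> \<open>u \<in> max_elems P\<close>
            maximal_subposet_low_rank[OF P t(1)] by (simp add: B_def)
        with min \<open>\<not> \<rho> t \<le> \<rho> u\<close> show False by blast
      qed
      then have "U \<subseteq> max_elems P"
        using u(2) U(2) new(2) new_max_elem[OF P(1) t(1)] by (meson leD order_trans subsetD subsetI)
      \<comment> \<open>Removing \<open>t\<close> and then \<open>U\<close> is now a single move from \<open>P\<close>.\<close>
      then have "ungar_move P (?Q - U)"
        using t(1) unfolding ungar_move_def by (intro exI[of _ "insert t U"]) auto
      then show ?thesis
        using atniss_win_iff_move_to_eeta_win[OF P(1)] U(3) by blast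
    qed
  qed
  then show ?case
    by (auto simp: decided_by_maximal_subposets_def eeta_win_def B_def)
qed

theorem theorem1p3:
  fixes P :: "'a::order set"
  assumes "finite P" and "graded_poset P"
  shows "eeta_win P \<longleftrightarrow> (\<forall>m \<in> max_elems P. eeta_win (maximal_subposet P m))"
proof -
  obtain \<rho> where "ranked_by \<rho> P"
    using assms(2) unfolding graded_poset_def ranked_by_def by blast
  with assms(1) have "decided_by_maximal_subposets P"
    by (rule ranked_decided_by_maximal_subposets)
  then show ?thesis
    by (simp only: decided_by_maximal_subposets_def)
qed

end
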